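(* Let $\hat{\mathbf z}\in\mathbb{R}^n_+\setminus\{\mathbf 0\}$, let $\mathbf z^{*}=\arg\min_{\mathbf z\in\mathbb Z}\|\mathbf z-\hat{\mathbf z}\|_2^2$, and (when $\mathcal{FH}_{\hat{\mathbf z}}\neq\emptyset$) let $\mathbf z^{**}=\arg\min_{\mathbf z\in\mathcal{FH}_{\hat{\mathbf z}}}\|\mathbf z-\hat{\mathbf z}\|_2^2$. Then: (a) $\mathbf z^{*}=\mathbf 0$ if and only if $\mathcal{FH}_{\hat{\mathbf z}}=\emptyset$; and (b) if $\mathcal{FH}_{\hat{\mathbf z}}\neq\emptyset$, then $$\mathbf z^{*}=\frac{\hat{\mathbf z}^T\hat{\mathbf z}}{\mathbf z^{**T}\mathbf z^{**}}\,\mathbf z^{**}.$$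
   Context: $\mathbb{R}^n_+$ is the set of vectors in $\mathbb{R}^n$ with nonnegative entries. $\mathbb Y=\{\mathbf y^1,\dots,\mathbf y^m\}\subset\mathbb{R}^n_+$ is a finite set containing at least one nonzero vector. $\mathbb X:=\mathrm{conv}(\mathbb Y)$ is its convex hull and $\mathbb Z:=\mathrm{cone}(\mathbb X)=\{\lambda\mathbf x:\mathbf x\in\mathbb X,\ \lambda\ge 0\}$ is the convex cone generated by $\mathbb Y$. For $\hat{\mathbf z}\in\mathbb{R}^n_+\setminus\{\mathbf 0\}$ define $\mathcal H_{\hat{\mathbf z}}:=\{\mathbf z\in\mathbb{R}^n_+ : \hat{\mathbf z}^T\mathbf z=\hat{\mathbf z}^T\hat{\mathbf z}\}$ and $\mathcal{FH}_{\hat{\mathbf z}}:=\mathcal H_{\hat{\mathbf z}}\cap\mathbb Z$. *)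

theory Defs
  imports "HOL-Analysis.Analysis"
begin

definition nonneg_orthant :: "(real ^ 'n) set" where
  "nonneg_orthant = {z. \<forall>i. 0 \<le> z $ i}"

definition gen_cone :: "(real ^ 'n) set \<Rightarrow> (real ^ 'n) set" where
  "gen_cone Y = {c *\<^sub>R x | c x. x \<in> convex hull Y \<and> 0 \<le> c}"

definition nonneg_hyperplane :: "real ^ 'n \<Rightarrow> (real ^ 'n) set" where
  "nonneg_hyperplane zh = {z \<in> nonneg_orthant. zh \<bullet> z = zh \<bullet> zh}"

definition feasible_hyperplane :: "(real ^ 'n) set \<Rightarrow> real ^ 'n \<Rightarrow> (real ^ 'n) set" where
  "feasible_hyperplane Y zh = nonneg_hyperplane zh \<inter> gen_cone Y"

text \<open>The library's \<open>arg_min_on\<close> is a choice operator.  The lemmas below show that the two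
  minimisation problems of interest have exactly one minimiser, so \<open>arg_min_on\<close> denotes it.\<close>

lemma gen_cone_eq_cone_hull: "gen_cone Y = cone hull (convex hull Y)"
  unfolding gen_cone_def cone_hull_expl by blast

lemma convex_gen_cone: "convex (gen_cone Y)"
  unfolding gen_cone_eq_cone_hull by (simp add: convex_cone_hull)

lemma closed_gen_cone:
  assumes "finite Y"
  shows "closed (gen_cone Y)"
proof -
  have "gen_cone Y = conic hull (convex hull Y)"
    unfolding gen_cone_def conic_hull_explicit by blast
  moreover have "polytope (convex hull Y)"
    using assms unfolding polytope_def by blast
  ultimately show ?thesis
    using closed_conic_hull_strong by metis
qed

lemma ex1_arg_min_norm:
  fixes S :: "(real ^ 'n) set"
  assumes "closed S" "convex S" "S \<noteq> {}"
  shows "\<exists>!z. is_arg_min (\<lambda>z. (norm (z - a))\<^sup>2) (\<lambda>z. z \<in> S) z"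
proof -
  have eq: "is_arg_min (\<lambda>z. (norm (z - a))\<^sup>2) (\<lambda>z. z \<in> S) z \<longleftrightarrow>
      z \<in> S \<and> (\<forall>y\<in>S. dist a z \<le> dist a y)" for z
    by (auto simp: is_arg_min_linorder dist_norm norm_minus_commute[of a] power2_le_iff_abs_le)
  show ?thesis
    unfolding eq
    using closest_point_exists[OF assms(1,3)] any_closest_point_unique[OF assms(2,1)]
    by metis
qed

lemma ex1_arg_min_gen_cone:
  assumes "finite Y" "Y \<noteq> {}"
  shows "\<exists>!z. is_arg_min (\<lambda>z. (norm (z - a))\<^sup>2) (\<lambda>z. z \<in> gen_cone Y) z"
proof (rule ex1_arg_min_norm)
  show "closed (gen_cone Y)"
    using closed_gen_cone assms by blast
  show "convex (gen_cone Y)"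
    by (rule convex_gen_cone)
  show "gen_cone Y \<noteq> {}"
    using assms by (simp add: gen_cone_eq_cone_hull flip: cone_hull_empty_iff)
qed

lemma ex1_arg_min_feasible_hyperplane:
  assumes "finite Y" "feasible_hyperplane Y zh \<noteq> {}"
  shows "\<exists>!z. is_arg_min (\<lambda>z. (norm (z - a))\<^sup>2) (\<lambda>z. z \<in> feasible_hyperplane Y zh) z"
proof (rule ex1_arg_min_norm)
  have eq: "nonneg_hyperplane zh = (\<Inter>i. {z. 0 \<le> z $ i}) \<inter> {z. zh \<bullet> z = zh \<bullet> zh}"
    by (auto simp: nonneg_hyperplane_def nonneg_orthant_def)
  have "closed (nonneg_hyperplane zh)"
    unfolding eq by (intro closed_Int closed_INT ballI closed_hyperplane closed_Collect_le continuous_intros)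
  then show "closed (feasible_hyperplane Y zh)"
    unfolding feasible_hyperplane_def using closed_gen_cone[OF assms(1)] by blast
  have "convex (nonneg_hyperplane zh)"
    by (auto simp: nonneg_hyperplane_def nonneg_orthant_def convex_def inner_add_right
        simp flip: distrib_right)
  then show "convex (feasible_hyperplane Y zh)"
    unfolding feasible_hyperplane_def using convex_gen_cone by (rule convex_Int)
qed (use assms in blast)

end

theory Submission
  imports Defs
begin

text \<open>The minimizer \<open>z*\<close> over the closed convex cone is characterised by
  \<open>zhat \<bullet> z* = z* \<bullet> z*\<close> and \<open>zhat \<bullet> z \<le> z* \<bullet> z\<close> on the cone.  So \<open>z* = 0\<close> iff \<open>zhat \<bullet> z \<le> 0\<close> on
  the whole cone, i.e. iff no ray of it meets the hyperplane.  On the hyperplane,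
  minimizing the distance to \<open>zhat\<close> amounts to minimizing the norm, and there
  \<open>zhat \<bullet> zhat = zhat \<bullet> z \<le> \<parallel>z*\<parallel> \<parallel>z\<parallel>\<close>, with equality for the multiple of \<open>z*\<close> lying in the
  hyperplane.\<close>

lemma arg_min_on_eqI:
  assumes "\<exists>!z. is_arg_min f (\<lambda>z. z \<in> S) z" "is_arg_min f (\<lambda>z. z \<in> S) x"
  shows "arg_min_on f S = x"
  unfolding arg_min_on_def arg_min_def using assms by (rule some1_equality)

lemma is_arg_min_arg_min_on:
  assumes "\<exists>!z. is_arg_min f (\<lambda>z. z \<in> S) z"
  shows "is_arg_min f (\<lambda>z. z \<in> S) (arg_min_on f S)"
  using assms arg_min_on_eqI by metis

lemma gen_cone_scaleR:
  assumes "z \<in> gen_cone Y" "0 \<le> c"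
  shows "c *\<^sub>R z \<in> gen_cone Y"
  using assms unfolding gen_cone_def by clarsimp (metis mult_nonneg_nonneg)

lemma convex_nonneg_orthant: "convex (nonneg_orthant :: (real ^ 'n) set)"
  by (auto simp: nonneg_orthant_def convex_def)

lemma gen_cone_subset_nonneg_orthant:
  assumes "Y \<subseteq> nonneg_orthant"
  shows "gen_cone Y \<subseteq> nonneg_orthant"
proof -
  have "convex hull Y \<subseteq> nonneg_orthant"
    using assms convex_nonneg_orthant by (rule hull_minimal)
  then show ?thesis
    by (fastforce simp: gen_cone_def nonneg_orthant_def)
qed

text \<open>The projection \<open>s\<close> of \<open>a\<close> onto a closed convex set satisfies
  the variational inequality \<open>(a - s) \<bullet> (y - s) \<le> 0\<close>. On a cone,
  \<open>y\<close> may also range over multiples of \<open>s\<close>, which makes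
  \<open>a - s\<close> orthogonal to \<open>s\<close>.\<close>

lemma is_arg_min_gen_cone_inner:
  fixes Y :: "(real ^ 'n) set"
  assumes "finite Y" and min: "is_arg_min (\<lambda>z. (norm (z - a))\<^sup>2) (\<lambda>z. z \<in> gen_cone Y) s"
  shows "a \<bullet> s = s \<bullet> s" and "z \<in> gen_cone Y \<Longrightarrow> a \<bullet> z \<le> s \<bullet> z"
proof -
  have s: "s \<in> gen_cone Y" "\<forall>y\<in>gen_cone Y. dist a s \<le> dist a y"
    using min
    by (auto simp: is_arg_min_linorder dist_norm norm_minus_commute[of a] power2_le_iff_abs_le)
  have var: "(a - s) \<bullet> (y - s) \<le> 0" if "y \<in> gen_cone Y" for y
    using any_closest_point_dot[OF convex_gen_cone closed_gen_cone[OF assms(1)] s(1) that s(2)] .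
  show eq: "a \<bullet> s = s \<bullet> s"
    \<comment> \<open>Testing with \<open>y = 0\<close> and \<open>y = 2 *\<^sub>R s\<close> bounds
      \<open>(a - s) \<bullet> s\<close> by 0 from below and from above.\<close>
    using var[OF gen_cone_scaleR[OF s(1), of 0]] var[OF gen_cone_scaleR[OF s(1), of 2]]
    by (simp add: inner_diff_left inner_diff_right scaleR_2 inner_add_right)
  show "a \<bullet> z \<le> s \<bullet> z" if "z \<in> gen_cone Y"
    using var[OF that] eq by (simp add: inner_diff_left inner_diff_right)
qed

theorem theorem1:
  fixes Y :: "(real ^ 'n) set" and zhat zs zss :: "real ^ 'n"
  assumes Y_finite: "finite Y"
    and Y_nonneg: "Y \<subseteq> nonneg_orthant"
    and Y_nonzero: "\<exists>y\<in>Y. y \<noteq> 0"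
    and zhat: "zhat \<in> nonneg_orthant - {0}"
    and zs: "zs = arg_min_on (\<lambda>z. (norm (z - zhat))\<^sup>2) (gen_cone Y)"
    and zss: "feasible_hyperplane Y zhat \<noteq> {} \<Longrightarrow>
      zss = arg_min_on (\<lambda>z. (norm (z - zhat))\<^sup>2) (feasible_hyperplane Y zhat)"
  shows "(zs = 0 \<longleftrightarrow> feasible_hyperplane Y zhat = {}) \<and>
    (feasible_hyperplane Y zhat \<noteq> {} \<longrightarrow> zs = ((zhat \<bullet> zhat) / (zss \<bullet> zss)) *\<^sub>R zss)"
proof -
  have "Y \<noteq> {}"
    using Y_nonzero by blast
  then have min: "is_arg_min (\<lambda>z. (norm (z - zhat))\<^sup>2) (\<lambda>z. z \<in> gen_cone Y) zs"
    unfolding zs by (intro is_arg_min_arg_min_on ex1_arg_min_gen_cone Y_finite)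
  then have zs_cone: "zs \<in> gen_cone Y"
    by (simp add: is_arg_min_def)
  note zs_eq = is_arg_min_gen_cone_inner(1)[OF Y_finite min]
  note zs_le = is_arg_min_gen_cone_inner(2)[OF Y_finite min]
  have a_pos: "zhat \<bullet> zhat > 0"
    using zhat by simp
  have F_iff: "z \<in> feasible_hyperplane Y zhat \<longleftrightarrow> z \<in> gen_cone Y \<and> zhat \<bullet> z = zhat \<bullet> zhat" for z
    using gen_cone_subset_nonneg_orthant[OF Y_nonneg]
    by (auto simp: feasible_hyperplane_def nonneg_hyperplane_def)
  have zs_nonzero: "zs \<noteq> 0" if ne: "feasible_hyperplane Y zhat \<noteq> {}"
  proof -
    obtain z where "z \<in> gen_cone Y" "zhat \<bullet> z = zhat \<bullet> zhat"
      using ne F_iff by blast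
    \<comment> \<open>If \<open>zs = 0\<close>, then
      \<open>zhat \<bullet> zhat = zhat \<bullet> z \<le> 0\<close>, a contradiction.\<close>
    then show ?thesis
      using zs_le[of z] a_pos by (metis inner_zero_left not_less)
  qed
  \<comment> \<open>The point where the ray through \<open>zs\<close> meets the hyperplane: as
    \<open>zhat \<bullet> zs = zs \<bullet> zs\<close>, this factor yields
    \<open>zhat \<bullet> p = zhat \<bullet> zhat\<close>.\<close>
  define p where "p = ((zhat \<bullet> zhat) / (zs \<bullet> zs)) *\<^sub>R zs"
  have p_F: "p \<in> feasible_hyperplane Y zhat" if "zs \<noteq> 0"
    using that zs_cone a_pos by (simp add: F_iff p_def gen_cone_scaleR zs_eq)
  have "zs = ((zhat \<bullet> zhat) / (zss \<bullet> zss)) *\<^sub>R zss" if ne: "feasible_hyperplane Y zhat \<noteq> {}"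
  proof -
    have nz: "zs \<noteq> 0"
      using zs_nonzero[OF ne] .
    have norm_p: "norm p = (zhat \<bullet> zhat) / norm zs"
      using nz a_pos by (simp add: p_def dot_square_norm power2_eq_square)
    have "(norm (p - zhat))\<^sup>2 \<le> (norm (z - zhat))\<^sup>2" if z: "z \<in> feasible_hyperplane Y zhat" for z
    proof -
      have "zhat \<bullet> zhat \<le> zs \<bullet> z"
        using z zs_le[of z] by (simp add: F_iff)
      also have "\<dots> \<le> norm zs * norm z"
        by (rule norm_cauchy_schwarz)
      finally have "norm p \<le> norm z"
        using nz by (simp add: norm_p divide_le_eq mult.commute)
      then have "(norm p)\<^sup>2 \<le> (norm z)\<^sup>2"
        by (simp add: power_mono)
      \<comment> \<open>The cross term \<open>2 * (zhat \<bullet> w)\<close> is constant on the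
        hyperplane.\<close>
      moreover have "(norm (w - zhat))\<^sup>2 = (norm w)\<^sup>2 - zhat \<bullet> zhat"
        if "w \<in> feasible_hyperplane Y zhat" for w
        using that
        by (simp add: F_iff power2_norm_eq_inner inner_diff_left inner_diff_right inner_commute)
      ultimately show ?thesis
        using z p_F[OF nz] by simp
    qed
    then have "is_arg_min (\<lambda>z. (norm (z - zhat))\<^sup>2) (\<lambda>z. z \<in> feasible_hyperplane Y zhat) p"
      using p_F[OF nz] by (simp add: is_arg_min_linorder)
    then have "zss = p"
      unfolding zss[OF ne] by (intro arg_min_on_eqI ex1_arg_min_feasible_hyperplane Y_finite ne)
    \<comment> \<open>The scaling inverts: \<open>p \<bullet> p = (zhat \<bullet> zhat)\<^sup>2 /
      (zs \<bullet> zs)\<close>, so the two factors cancel.\<close>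
    then show ?thesis
      using nz a_pos by (simp add: p_def)
  qed
  \<comment> \<open>For (a), a nonzero \<open>zs\<close> makes \<open>p\<close> a witness that the
    feasible set is nonempty.\<close>
  then show ?thesis
    using zs_nonzero p_F by blast
qed

end
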